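(* Let $T: \mathbb{C}^m \rightarrow \mathbb{C}^n$ be a nonzero linear operator and let $0 \leq \delta \leq 1$ be such that $\delta\, \frac{\|T\|_2^4}{\|T\|_4^4}$ is a positive integer. Then there is a subset $\sigma \subset [m]$ of size $$|\sigma| = \delta\, \frac{\|T\|_2^4}{\|T\|_4^4}$$ such that, letting $c = \frac{|\sigma|}{m}$, $$s_{\min}\left(T|_{P_{\sigma}\mathbb{C}^m}\right) \geq \frac{\|T\|_2}{\sqrt{m}}\left[\sqrt{1-c}-\sqrt{\delta-c}\right].$$
   Context: $[m]=\{1,\dots,m\}$. $\|T\|_p = (\sum_k s_k(T)^p)^{1/p}$ is the Schatten $p$-norm, where $s_k(T)$ are the singular values of $T$ (so $\|T\|_2$ is the Frobenius norm). $P_\sigma$ is the orthogonal projection of $\mathbb{C}^m$ onto the span of the standard basis vectors $e_i$, $i\in\sigma$; $T|_{P_\sigma\mathbb{C}^m}$ is the restriction of $T$ to this $|\sigma|$-dimensional subspace, and $s_{\min}$ is its smallest singular value, i.e. the minimum of $\|Tv\|$ over unit vectors $v\in P_\sigma\mathbb{C}^m$. *)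

theory Defs
  imports "Jordan_Normal_Form.Schur_Decomposition" "HOL-Analysis.L2_Norm"
begin

(* A linear operator from C^m to C^n is its matrix in carrier_mat n m (n rows, m columns).
   Following the indexing of the matrix library, the index set [m] is {0..<m}. *)

(* The singular values are the square roots of the eigenvalues of T^* T, with multiplicity.
   T^* T is positive semidefinite, so its eigenvalues are nonnegative reals and Re only
   changes their type. There are dim_col T of them, zeros included; the zeros do not
   contribute to Schatten norms, as 0 powr p = 0. *)
definition singular_values :: "complex mat \<Rightarrow> real multiset" where
  "singular_values T = image_mset (\<lambda>z. sqrt (Re z)) (proots (char_poly (mat_adjoint T * T)))"

definition schatten_norm :: "real \<Rightarrow> complex mat \<Rightarrow> real" where
  "schatten_norm p T = (\<Sum>s\<in>#singular_values T. s powr p) powr (1 / p)"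

definition vnorm :: "complex vec \<Rightarrow> real" where
  "vnorm v = L2_set (\<lambda>i. cmod (v $ i)) {0..<dim_vec v}"

(* In the standard basis, the orthogonal projection of C^m onto the span of the e_i with
   i in sigma is the diagonal 0/1 matrix with ones exactly at the indices in sigma. *)
definition coord_proj :: "nat \<Rightarrow> nat set \<Rightarrow> complex mat" where
  "coord_proj m \<sigma> = mat m m (\<lambda>(i, j). if i = j \<and> i \<in> \<sigma> then 1 else 0)"

definition coord_subspace :: "nat \<Rightarrow> nat set \<Rightarrow> complex vec set" where
  "coord_subspace m \<sigma> = (\<lambda>v. coord_proj m \<sigma> *\<^sub>v v) ` carrier_vec m"

(* The smallest singular value of the restriction of T to the subspace V. The infimum is a
   minimum whenever V is nonzero, by compactness of the unit sphere of V; for V = 0 the value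
   is junk. *)
definition s_min :: "complex mat \<Rightarrow> complex vec set \<Rightarrow> real" where
  "s_min T V = Inf {vnorm (T *\<^sub>v v) | v. v \<in> V \<and> vnorm v = 1}"

end

theory Submission
  imports Defs
begin

text \<open>
  Put \<open>A = T\<^sup>* T\<close>, with eigenvalues \<open>e\<close>, and for \<open>b\<close> below the spectrum of a principal
  submatrix \<open>B\<close> consider the barrier \<open>tr ((B - b)\<^sup>-\<^sup>1)\<close>.  If it is at most \<open>\<phi>\<close>, then some row and
  column of \<open>B\<close> can be deleted so that the barrier at \<open>b + 1/\<phi>\<close> is still at most \<open>\<phi>\<close>: the
  characteristic polynomials of the minors sum to the derivative of that of \<open>B\<close>, and the
  barrier of the derivative is controlled by the Cauchy--Schwarz inequality.  Starting at \<open>b = -t\<close>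
  and deleting \<open>m - k\<close> indices, the least eigenvalue of the remaining submatrix is at least
  \<open>-t + (m - k)/\<phi>\<close>.  Among spectra with given \<open>\<Sum>e\<close> and \<open>\<Sum>e\<^sup>2\<close> the initial barrier is largest when
  the eigenvalues are \<open>0\<close> and \<open>\<Sum>e\<^sup>2 / \<Sum>e\<close>; optimising \<open>t\<close> for this \<open>\<phi>\<close> gives the bound.
\<close>

subsection \<open>Quadratic forms of kernels\<close>

text \<open>Vectors and matrices are plain functions whose values at indices from \<open>n\<close>
  on are ignored; passing to a principal submatrix is then composition with an index map.\<close>

definition inner_fun :: "nat \<Rightarrow> (nat \<Rightarrow> complex) \<Rightarrow> (nat \<Rightarrow> complex) \<Rightarrow> complex" where
  "inner_fun n x y = (\<Sum>i<n. cnj (x i) * y i)"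

definition apply_kernel :: "nat \<Rightarrow> (nat \<Rightarrow> nat \<Rightarrow> complex) \<Rightarrow> (nat \<Rightarrow> complex) \<Rightarrow> nat \<Rightarrow> complex" where
  "apply_kernel n a x = (\<lambda>i. \<Sum>j<n. a i j * x j)"

definition sqnorm :: "nat \<Rightarrow> (nat \<Rightarrow> complex) \<Rightarrow> real" where
  "sqnorm n x = (\<Sum>i<n. (cmod (x i))\<^sup>2)"

definition quad_form :: "nat \<Rightarrow> (nat \<Rightarrow> nat \<Rightarrow> complex) \<Rightarrow> (nat \<Rightarrow> complex) \<Rightarrow> real" where
  "quad_form n a x = Re (inner_fun n x (apply_kernel n a x))"

text \<open>Required for all indices, not only those below some \<open>n\<close>, so that it
  survives any reindexing.\<close>

definition hermitian_kernel :: "(nat \<Rightarrow> nat \<Rightarrow> complex) \<Rightarrow> bool" where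
  "hermitian_kernel a \<longleftrightarrow> (\<forall>i j. a j i = cnj (a i j))"

definition kernel_mat :: "nat \<Rightarrow> (nat \<Rightarrow> nat \<Rightarrow> complex) \<Rightarrow> complex mat" where
  "kernel_mat n a = mat n n (\<lambda>(i, j). a i j)"

lemma kernel_mat_carrier [simp]: "kernel_mat n a \<in> carrier_mat n n"
  by (simp add: kernel_mat_def)

lemma inner_fun_self: "inner_fun n x x = of_real (sqnorm n x)"
  unfolding inner_fun_def sqnorm_def of_real_sum
  by (intro sum.cong refl) (simp add: complex_norm_square[symmetric] mult.commute)

lemma inner_fun_commute: "inner_fun n y x = cnj (inner_fun n x y)"
  by (simp add: inner_fun_def mult.commute)

lemma inner_fun_add_right: "inner_fun n x (\<lambda>i. y i + z i) = inner_fun n x y + inner_fun n x z"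
  by (simp add: inner_fun_def algebra_simps sum.distrib)

lemma inner_fun_scale_right: "inner_fun n x (\<lambda>i. c * y i) = c * inner_fun n x y"
  by (simp add: inner_fun_def sum_distrib_left algebra_simps)

lemma inner_fun_add_left: "inner_fun n (\<lambda>i. x i + z i) y = inner_fun n x y + inner_fun n z y"
  by (simp add: inner_fun_def algebra_simps sum.distrib)

lemma inner_fun_scale_left: "inner_fun n (\<lambda>i. c * x i) y = cnj c * inner_fun n x y"
  by (simp add: inner_fun_def sum_distrib_left algebra_simps)

lemma inner_fun_cong:
  "(\<And>i. i < n \<Longrightarrow> x i = x' i) \<Longrightarrow> (\<And>i. i < n \<Longrightarrow> y i = y' i) \<Longrightarrow> inner_fun n x y = inner_fun n x' y'"
  by (auto simp: inner_fun_def)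

lemma apply_kernel_add:
  "apply_kernel n a (\<lambda>i. x i + c * y i) = (\<lambda>i. apply_kernel n a x i + c * apply_kernel n a y i)"
  by (rule ext) (simp add: apply_kernel_def algebra_simps sum.distrib sum_distrib_left)

lemma inner_fun_hermitian:
  assumes "hermitian_kernel a"
  shows "inner_fun n (apply_kernel n a x) y = inner_fun n x (apply_kernel n a y)"
proof -
  have a: "cnj (a i j) = a j i" for i j using assms by (metis hermitian_kernel_def)
  have "inner_fun n (apply_kernel n a x) y = (\<Sum>i<n. \<Sum>j<n. cnj (a i j) * cnj (x j) * y i)"
    by (simp add: inner_fun_def apply_kernel_def sum_distrib_right)
  also have "\<dots> = (\<Sum>j<n. \<Sum>i<n. cnj (a i j) * cnj (x j) * y i)"
    by (rule sum.swap)
  also have "\<dots> = inner_fun n x (apply_kernel n a y)"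
    by (simp add: inner_fun_def apply_kernel_def sum_distrib_left a mult_ac)
  finally show ?thesis .
qed

text \<open>The two cross terms are conjugate to each other because \<open>a\<close> is Hermitian,
  so their real parts agree.\<close>

lemma quad_form_shift:
  assumes "hermitian_kernel a"
  shows "quad_form n a (\<lambda>i. x i + of_real t * y i) =
    quad_form n a x + 2 * t * Re (inner_fun n y (apply_kernel n a x)) + t\<^sup>2 * quad_form n a y"
proof -
  have "Re (inner_fun n x (apply_kernel n a y)) = Re (inner_fun n y (apply_kernel n a x))"
    using inner_fun_hermitian[OF assms, of n x y] inner_fun_commute[of n y "apply_kernel n a x"]
    by simp
  then show ?thesis
    by (simp add: quad_form_def apply_kernel_add inner_fun_add_left inner_fun_add_right
        inner_fun_scale_left inner_fun_scale_right algebra_simps power2_eq_square)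
qed

lemma sqnorm_nonneg [simp]: "0 \<le> sqnorm n x"
  by (simp add: sqnorm_def sum_nonneg)

lemma sqnorm_eq_0_iff: "sqnorm n x = 0 \<longleftrightarrow> (\<forall>i<n. x i = 0)"
  by (auto simp: sqnorm_def sum_nonneg_eq_0_iff)

text \<open>Cauchy--Schwarz in every row; the constant is the squared Frobenius norm of
  \<open>a\<close>.\<close>

lemma sqnorm_apply_le:
  "sqnorm n (apply_kernel n a x) \<le> (\<Sum>i<n. sqnorm n (a i)) * sqnorm n x"
proof -
  have "(cmod (\<Sum>j<n. a i j * x j))\<^sup>2 \<le> sqnorm n (a i) * sqnorm n x" for i
  proof -
    have "cmod (\<Sum>j<n. a i j * x j) \<le> (\<Sum>j<n. cmod (a i j) * cmod (x j))"
      by (rule order.trans[OF norm_sum]) (simp add: norm_mult)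
    then have "(cmod (\<Sum>j<n. a i j * x j))\<^sup>2 \<le> (\<Sum>j<n. cmod (a i j) * cmod (x j))\<^sup>2"
      by (simp add: power_mono)
    also have "\<dots> \<le> sqnorm n (a i) * sqnorm n x"
      using power_mono[OF L2_set_mult_ineq[of "\<lambda>j. cmod (a i j)" "\<lambda>j. cmod (x j)" "{..<n}"], of 2]
      by (simp add: sqnorm_def L2_set_def power_mult_distrib sum_nonneg)
    finally show ?thesis .
  qed
  then show ?thesis
    unfolding apply_kernel_def
    by (subst sqnorm_def) (auto simp: sum_distrib_right intro: sum_mono)
qed

text \<open>A crude bound by \<open>2 u v \<le> u^2 + v^2\<close> in each coordinate: the form is
  bounded on the unit sphere and vanishes where \<open>sqnorm\<close> does.\<close>

lemma abs_quad_form_le: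
  "\<bar>quad_form n a x\<bar> \<le> (1 + (\<Sum>i<n. sqnorm n (a i))) * sqnorm n x"
proof -
  let ?y = "apply_kernel n a x"
  have "\<bar>quad_form n a x\<bar> \<le> (\<Sum>i<n. cmod (x i) * cmod (?y i))"
    unfolding quad_form_def inner_fun_def
    by (rule order.trans[OF abs_Re_le_cmod], rule order.trans[OF norm_sum]) (simp add: norm_mult)
  also have "\<dots> \<le> (\<Sum>i<n. (cmod (x i))\<^sup>2 + (cmod (?y i))\<^sup>2)"
  proof (rule sum_mono)
    fix i
    have "2 * (cmod (x i) * cmod (?y i)) \<le> (cmod (x i))\<^sup>2 + (cmod (?y i))\<^sup>2"
      using sum_squares_bound[of "cmod (x i)" "cmod (?y i)"] by simp
    moreover have "0 \<le> cmod (x i) * cmod (?y i)" by simp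
    ultimately show "cmod (x i) * cmod (?y i) \<le> (cmod (x i))\<^sup>2 + (cmod (?y i))\<^sup>2" by linarith
  qed
  also have "\<dots> = sqnorm n x + sqnorm n ?y" by (simp add: sqnorm_def sum.distrib)
  also have "\<dots> \<le> (1 + (\<Sum>i<n. sqnorm n (a i))) * sqnorm n x"
    using sqnorm_apply_le[of n a x] by (simp add: algebra_simps)
  finally show ?thesis .
qed

text \<open>A descent step: the form is nonnegative at \<open>x - y / C\<close>, where
  \<open>y\<close> is the image of \<open>x\<close>, and expanding it there bounds the norm of
  \<open>y\<close>.\<close>

lemma sqnorm_apply_le_quad_form:
  assumes a: "hermitian_kernel a" and psd: "\<And>x. 0 \<le> quad_form n a x"
  shows "sqnorm n (apply_kernel n a x) \<le> (1 + (\<Sum>i<n. sqnorm n (a i))) * quad_form n a x"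
proof -
  define C where "C = 1 + (\<Sum>i<n. sqnorm n (a i))"
  have C: "C > 0" unfolding C_def by (intro add_pos_nonneg sum_nonneg) auto
  let ?y = "apply_kernel n a x"
  have y: "quad_form n a ?y \<le> C * sqnorm n ?y"
    using abs_quad_form_le[of n a ?y] by (simp add: C_def)
  have "0 \<le> quad_form n a (\<lambda>i. x i + of_real (- 1 / C) * ?y i)" by (rule psd)
  also have "\<dots> = quad_form n a x - 2 / C * sqnorm n ?y + (1 / C)\<^sup>2 * quad_form n a ?y"
    unfolding quad_form_shift[OF a] by (simp add: inner_fun_self power2_eq_square)
  also have "\<dots> \<le> quad_form n a x - 2 / C * sqnorm n ?y + (1 / C)\<^sup>2 * (C * sqnorm n ?y)"
    using y by (intro add_left_mono mult_left_mono) auto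
  also have "\<dots> = quad_form n a x - sqnorm n ?y / C"
    using C by (simp add: power2_eq_square field_simps)
  finally show ?thesis using C by (simp add: C_def field_simps)
qed

lemma eigenvalue_kernel_mat:
  "eigenvalue (kernel_mat n a) k \<longleftrightarrow>
    (\<exists>x. sqnorm n x \<noteq> 0 \<and> (\<forall>i<n. apply_kernel n a x i = k * x i))"
proof
  assume "eigenvalue (kernel_mat n a) k"
  then obtain v where v: "v \<in> carrier_vec n" "v \<noteq> 0\<^sub>v n" "kernel_mat n a *\<^sub>v v = k \<cdot>\<^sub>v v"
    by (auto simp: eigenvalue_def eigenvector_def kernel_mat_def)
  have "sqnorm n (\<lambda>i. v $ i) \<noteq> 0"
    using v(1,2) unfolding sqnorm_eq_0_iff by (auto simp: vec_eq_iff)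
  moreover have "apply_kernel n a (\<lambda>i. v $ i) i = k * v $ i" if "i < n" for i
  proof -
    have "(kernel_mat n a *\<^sub>v v) $ i = k * v $ i" using v that by simp
    then show ?thesis using v(1) that
      by (simp add: kernel_mat_def scalar_prod_def apply_kernel_def lessThan_atLeast0)
  qed
  ultimately show "\<exists>x. sqnorm n x \<noteq> 0 \<and> (\<forall>i<n. apply_kernel n a x i = k * x i)" by blast
next
  assume "\<exists>x. sqnorm n x \<noteq> 0 \<and> (\<forall>i<n. apply_kernel n a x i = k * x i)"
  then obtain x where x: "sqnorm n x \<noteq> 0" "\<And>i. i < n \<Longrightarrow> apply_kernel n a x i = k * x i" by blast
  have "vec n x \<noteq> 0\<^sub>v n" using x(1) unfolding sqnorm_eq_0_iff by (auto simp: vec_eq_iff)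
  moreover have "kernel_mat n a *\<^sub>v vec n x = k \<cdot>\<^sub>v vec n x"
    by (rule eq_vecI)
      (auto simp: kernel_mat_def scalar_prod_def x(2)[unfolded apply_kernel_def] lessThan_atLeast0[symmetric])
  ultimately show "eigenvalue (kernel_mat n a) k"
    unfolding eigenvalue_def eigenvector_def by (intro exI[of _ "vec n x"]) (simp add: kernel_mat_def)
qed

text \<open>Pairing the eigenvector equation with \<open>x\<close> gives a Rayleigh quotient, real
  since \<open>a\<close> is Hermitian. This form also transfers lower bounds of the quadratic form
  to the eigenvalues.\<close>

lemma hermitian_eigenvalue:
  assumes a: "hermitian_kernel a" and ev: "eigenvalue (kernel_mat n a) k"
  obtains x where "sqnorm n x > 0" "k = of_real (quad_form n a x / sqnorm n x)"
proof -
  obtain x where x: "sqnorm n x \<noteq> 0" "\<And>i. i < n \<Longrightarrow> apply_kernel n a x i = k * x i"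
    using ev unfolding eigenvalue_kernel_mat by blast
  have "inner_fun n x (apply_kernel n a x) = inner_fun n x (\<lambda>i. k * x i)"
    using x(2) by (intro inner_fun_cong) auto
  then have 1: "inner_fun n x (apply_kernel n a x) = k * of_real (sqnorm n x)"
    by (simp add: inner_fun_scale_right inner_fun_self)
  have "cnj (inner_fun n x (apply_kernel n a x)) = inner_fun n x (apply_kernel n a x)"
    using inner_fun_commute[of n "apply_kernel n a x" x] inner_fun_hermitian[OF a, of n x x] by simp
  then have "inner_fun n x (apply_kernel n a x) = of_real (quad_form n a x)"
    unfolding quad_form_def by (simp add: Reals_cnj_iff)
  with 1 x(1) have "k = of_real (quad_form n a x / sqnorm n x)" by (simp add: field_simps)
  moreover have "sqnorm n x > 0" using x(1) sqnorm_nonneg[of n x] by linarith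
  ultimately show ?thesis using that by blast
qed

subsection \<open>The Rayleigh bound for Hermitian kernels\<close>

definition kernel_shift :: "(nat \<Rightarrow> nat \<Rightarrow> complex) \<Rightarrow> real \<Rightarrow> nat \<Rightarrow> nat \<Rightarrow> complex" where
  "kernel_shift a c = (\<lambda>i j. a i j - (if i = j then of_real c else 0))"

lemma hermitian_kernel_shift:
  assumes "hermitian_kernel a"
  shows "hermitian_kernel (kernel_shift a c)"
  unfolding hermitian_kernel_def
proof (intro allI)
  fix i j
  have "a j i = cnj (a i j)" using assms unfolding hermitian_kernel_def by blast
  then show "kernel_shift a c j i = cnj (kernel_shift a c i j)"
    unfolding kernel_shift_def complex_cnj_diff by (simp only:) simp
qed

lemma apply_kernel_shift:
  assumes "i < n"
  shows "apply_kernel n (kernel_shift a c) x i = apply_kernel n a x i - of_real c * x i"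
proof -
  have "apply_kernel n (kernel_shift a c) x i =
      (\<Sum>j<n. a i j * x j - (if j = i then of_real c * x i else 0))"
    unfolding apply_kernel_def kernel_shift_def
    by (intro sum.cong refl) (auto simp: left_diff_distrib)
  then show ?thesis
    using assms by (simp add: sum_subtractf apply_kernel_def)
qed

lemma quad_form_kernel_shift:
  "quad_form n (kernel_shift a c) x = quad_form n a x - c * sqnorm n x"
proof -
  have "inner_fun n x (apply_kernel n (kernel_shift a c) x) =
      inner_fun n x (\<lambda>i. apply_kernel n a x i + (- of_real c) * x i)"
    by (rule inner_fun_cong) (auto simp: apply_kernel_shift)
  then show ?thesis
    by (simp only: quad_form_def inner_fun_add_right inner_fun_scale_right inner_fun_self) simp
qed

text \<open>If \<open>0\<close> is no eigenvalue, the determinant is nonzero and there is an inverse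
  matrix; \<open>K\<close> is its squared Frobenius norm.\<close>

lemma bounded_inverse:
  assumes "\<not> eigenvalue (kernel_mat n a) 0"
  obtains K where "K \<ge> 0" "\<And>x. sqnorm n x \<le> K * sqnorm n (apply_kernel n a x)"
proof -
  let ?A = "kernel_mat n a"
  have "det ?A \<noteq> 0"
  proof
    assume "det ?A = 0"
    then obtain v where v: "v \<in> carrier_vec n" "v \<noteq> 0\<^sub>v n" "?A *\<^sub>v v = 0\<^sub>v n"
      using det_0_iff_vec_prod_zero[of ?A n] by auto
    then have "eigenvector ?A v 0"
      unfolding eigenvector_def by (auto simp: kernel_mat_def)
    with assms show False unfolding eigenvalue_def by blast
  qed
  then obtain B where B: "B \<in> carrier_mat n n" "B * ?A = 1\<^sub>m n"
    using det_non_zero_imp_unit[of ?A n] by (auto simp: Units_def ring_mat_def)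
  define b where "b = (\<lambda>i j. B $$ (i, j))"
  have "apply_kernel n b (apply_kernel n a x) i = x i" if i: "i < n" for x i
  proof -
    have v: "vec n x \<in> carrier_vec n" by simp
    have 1: "?A *\<^sub>v vec n x = vec n (apply_kernel n a x)"
      by (rule eq_vecI) (auto simp: kernel_mat_def scalar_prod_def apply_kernel_def lessThan_atLeast0)
    have "B *\<^sub>v (?A *\<^sub>v vec n x) = vec n x"
      using assoc_mult_mat_vec[OF B(1) kernel_mat_carrier[of n a] v] B(2) by simp
    then have "(B *\<^sub>v (?A *\<^sub>v vec n x)) $ i = x i" using i by simp
    then show ?thesis using i B(1)
      by (simp add: 1 scalar_prod_def lessThan_atLeast0 b_def apply_kernel_def[of n "\<lambda>i j. B $$ (i, j)"])
  qed
  then have "sqnorm n x = sqnorm n (apply_kernel n b (apply_kernel n a x))" for x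
    by (simp add: sqnorm_def)
  then have "sqnorm n x \<le> (\<Sum>i<n. sqnorm n (b i)) * sqnorm n (apply_kernel n a x)" for x
    using sqnorm_apply_le[of n b "apply_kernel n a x"] by (rule ord_eq_le_trans)
  then show ?thesis by (rule that[rotated]) (simp add: sum_nonneg)
qed

text \<open>The infimum of the Rayleigh quotient is an eigenvalue: otherwise the shifted form
  would be bounded below by a positive multiple of the norm, as its kernel would be invertible.\<close>

lemma quad_form_ge:
  assumes a: "hermitian_kernel a"
    and ev: "\<And>e. eigenvalue (kernel_mat n a) (complex_of_real e) \<Longrightarrow> b \<le> e"
  shows "b * sqnorm n x \<le> quad_form n a x"
proof (cases "\<exists>y. sqnorm n y \<noteq> 0")
  \<comment> \<open>Here \<open>n = 0\<close>: there are no Rayleigh quotients to take an infimum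
    of, and both sides are \<open>0\<close>.\<close>
  case False
  then show ?thesis using abs_quad_form_le[of n a x] by simp
next
  case True
  then obtain y where y: "sqnorm n y > 0" using sqnorm_nonneg order_le_less by metis
  define R where "R = (\<lambda>x. quad_form n a x / sqnorm n x) ` {x. sqnorm n x > 0}"
  define l where "l = Inf R"
  have ne: "R \<noteq> {}" using y by (auto simp: R_def)
  define C0 where "C0 = 1 + (\<Sum>i<n. sqnorm n (a i))"
  have bdd: "bdd_below R"
  proof (rule bdd_belowI[of _ "- C0"])
    fix r assume "r \<in> R"
    then obtain x where x: "sqnorm n x > 0" "r = quad_form n a x / sqnorm n x" by (auto simp: R_def)
    have "- (C0 * sqnorm n x) \<le> quad_form n a x"
      using abs_quad_form_le[of n a x] unfolding C0_def by linarith
    then show "- C0 \<le> r" unfolding x(2) using x(1) by (simp add: pos_le_divide_eq)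
  qed
  have zero: "quad_form n c x = 0" if "sqnorm n x = 0" for c x
    using abs_quad_form_le[of n c x] that by simp
  have l: "l * sqnorm n x \<le> quad_form n a x" for x
  proof (cases "sqnorm n x = 0")
    case False
    then have "sqnorm n x > 0" using sqnorm_nonneg[of n x] by linarith
    then have "l \<le> quad_form n a x / sqnorm n x"
      unfolding l_def by (intro cInf_lower bdd) (auto simp: R_def)
    then show ?thesis using \<open>sqnorm n x > 0\<close> by (simp add: field_simps)
  qed (simp add: zero)
  let ?m = "kernel_shift a l"
  have m: "hermitian_kernel ?m" by (rule hermitian_kernel_shift[OF a])
  have psd: "0 \<le> quad_form n ?m x" for x
    using l[of x] by (simp add: quad_form_kernel_shift)
  have "eigenvalue (kernel_mat n a) (of_real l)"
  proof (rule ccontr)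
    assume no: "\<not> eigenvalue (kernel_mat n a) (of_real l)"
    have "\<not> eigenvalue (kernel_mat n ?m) 0"
      using no unfolding eigenvalue_kernel_mat by (simp add: apply_kernel_shift)
    then obtain K where K: "K \<ge> 0" "\<And>x. sqnorm n x \<le> K * sqnorm n (apply_kernel n ?m x)"
      by (rule bounded_inverse) blast
    define C where "C = 1 + (\<Sum>i<n. sqnorm n (?m i))"
    have C: "C > 0" unfolding C_def by (intro add_pos_nonneg sum_nonneg) auto
    define D where "D = K * C"
    have D0: "D \<ge> 0" using K C by (simp add: D_def)
    \<comment> \<open>Invertibility bounds \<open>x\<close> by its image under the shifted kernel,
      and positive semidefiniteness bounds this image by the shifted form.\<close>
    have D: "sqnorm n x \<le> D * (quad_form n a x - l * sqnorm n x)" for x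
    proof -
      have "sqnorm n x \<le> K * sqnorm n (apply_kernel n ?m x)" by (rule K)
      also have "\<dots> \<le> K * (C * quad_form n ?m x)"
        unfolding C_def by (intro mult_left_mono sqnorm_apply_le_quad_form m psd K)
      finally show ?thesis by (simp add: quad_form_kernel_shift D_def mult.assoc)
    qed
    have "D \<noteq> 0" using D[of y] y by auto
    with D0 have D0: "D > 0" by simp
    have "l + 1 / D \<le> Inf R"
    proof (rule cInf_greatest[OF ne])
      fix r assume "r \<in> R"
      then obtain x where x: "sqnorm n x > 0" "r = quad_form n a x / sqnorm n x" by (auto simp: R_def)
      have "sqnorm n x / D \<le> quad_form n a x - l * sqnorm n x"
        using D[of x] D0 by (simp add: pos_divide_le_eq mult.commute)
      then show "l + 1 / D \<le> r"
        unfolding x(2) using x(1) by (simp add: pos_le_divide_eq algebra_simps)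
    qed
    then show False using D0 by (simp add: l_def)
  qed
  then have "b \<le> l" by (rule ev)
  then show ?thesis using l[of x] mult_right_mono[of b l "sqnorm n x"] by simp
qed

section \<open>Real spectra, kept as multisets of roots\<close>

definition real_rooted :: "real multiset \<Rightarrow> complex poly" where
  "real_rooted E = (\<Prod>e\<in>#E. [:- complex_of_real e, 1:])"

lemma proots_real_rooted: "proots (real_rooted E) = image_mset complex_of_real E"
proof (induction E)
  case (add e E)
  have "real_rooted E \<noteq> 0" by (auto simp: real_rooted_def)
  then have "proots ([:- complex_of_real e, 1:] * real_rooted E) = {#of_real e#} + image_mset of_real E"
    by (subst proots_mult) (auto simp: add.IH)
  then show ?case by (simp add: real_rooted_def)
qed (simp add: real_rooted_def)

lemma poly_real_rooted_eq_0: "poly (real_rooted E) z = 0 \<longleftrightarrow> z \<in> complex_of_real ` set_mset E"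
  by (induction E) (auto simp: real_rooted_def)

text \<open>The characteristic polynomial splits over the complex numbers, and each root, being a
  Rayleigh quotient, is real.\<close>

lemma hermitian_char_poly:
  assumes a: "hermitian_kernel a"
  obtains E where "char_poly (kernel_mat n a) = real_rooted E" "size E = n"
proof -
  let ?p = "char_poly (kernel_mat n a)"
  obtain as where as: "?p = (\<Prod>z\<leftarrow>as. [:- z, 1:])" "length as = n"
    using char_poly_factorized[of "kernel_mat n a" n] by auto
  have "z = of_real (Re z)" if "z \<in> set as" for z
  proof -
    have "poly ?p z = 0" using that unfolding as(1) by (induction as) auto
    then have "eigenvalue (kernel_mat n a) z"
      using eigenvalue_root_char_poly[of "kernel_mat n a" n] by simp
    then show ?thesis using hermitian_eigenvalue[OF a] by (metis Re_complex_of_real)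
  qed
  then have "?p = (\<Prod>z\<leftarrow>map Re as. [:- complex_of_real z, 1:])"
    unfolding as(1) by (auto intro!: arg_cong[of _ _ prod_list])
  also have "\<dots> = real_rooted (mset (map Re as))"
    by (simp only: real_rooted_def mset_map[symmetric] prod_mset_prod_list)
  finally show ?thesis using that[of "mset (map Re as)"] as(2) by simp
qed

lemma eigenvalue_iff_mem:
  assumes "char_poly (kernel_mat n a) = real_rooted E"
  shows "eigenvalue (kernel_mat n a) (of_real e) \<longleftrightarrow> e \<in># E"
  using eigenvalue_root_char_poly[of "kernel_mat n a" n "of_real e"] assms
  by (auto simp: poly_real_rooted_eq_0)

section \<open>Restriction to a set of coordinates\<close>

lemma sqnorm_reindex:
  assumes f: "inj_on f {..<k}" "f ` {..<k} \<subseteq> {..<n}" and x: "\<And>i. i < n \<Longrightarrow> i \<notin> f ` {..<k} \<Longrightarrow> x i = 0"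
  shows "sqnorm n x = sqnorm k (x \<circ> f)"
proof -
  have "sqnorm n x = (\<Sum>i\<in>f ` {..<k}. (cmod (x i))\<^sup>2)"
    unfolding sqnorm_def using f(2) x by (intro sum.mono_neutral_right) auto
  also have "\<dots> = sqnorm k (x \<circ> f)"
    unfolding sqnorm_def using f(1) by (simp add: sum.reindex)
  finally show ?thesis .
qed

lemma quad_form_reindex:
  assumes f: "inj_on f {..<k}" "f ` {..<k} \<subseteq> {..<n}" and x: "\<And>i. i < n \<Longrightarrow> i \<notin> f ` {..<k} \<Longrightarrow> x i = 0"
  shows "quad_form n a x = quad_form k (\<lambda>p q. a (f p) (f q)) (x \<circ> f)"
proof -
  have red: "(\<Sum>i<n. g i * x i) = (\<Sum>p<k. g (f p) * x (f p))" for g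
  proof -
    have "(\<Sum>i<n. g i * x i) = (\<Sum>i\<in>f ` {..<k}. g i * x i)"
      using f(2) x by (intro sum.mono_neutral_right) auto
    then show ?thesis using f(1) by (simp add: sum.reindex)
  qed
  have red': "(\<Sum>i<n. cnj (x i) * g i) = (\<Sum>p<k. cnj (x (f p)) * g (f p))" for g
  proof -
    have "(\<Sum>i<n. cnj (x i) * g i) = (\<Sum>i\<in>f ` {..<k}. cnj (x i) * g i)"
      using f(2) x by (intro sum.mono_neutral_right) auto
    then show ?thesis using f(1) by (simp add: sum.reindex)
  qed
  show ?thesis
    unfolding quad_form_def inner_fun_def apply_kernel_def o_def by (simp only: red red')
qed

text \<open>Extending \<open>x\<close> by zero outside the range of \<open>f\<close> preserves norm
  and form. This is the half of Cauchy interlacing that keeps the least eigenvalue from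
  decreasing.\<close>

lemma quad_form_principal_ge:
  assumes f: "inj_on f {..<k}" "f ` {..<k} \<subseteq> {..<n}"
    and b: "\<And>x. b * sqnorm n x \<le> quad_form n a x"
  shows "b * sqnorm k x \<le> quad_form k (\<lambda>p q. a (f p) (f q)) x"
proof -
  define y where "y = (\<lambda>i. if i \<in> f ` {..<k} then x (the_inv_into {..<k} f i) else 0)"
  define z where "z = y \<circ> f"
  have y0: "y i = 0" if "i < n" "i \<notin> f ` {..<k}" for i
    using that by (simp add: y_def)
  have z: "z p = x p" if "p < k" for p
    using that f(1) by (simp add: z_def y_def the_inv_into_f_f)
  have "quad_form n a y = quad_form k (\<lambda>p q. a (f p) (f q)) z"
    unfolding z_def by (rule quad_form_reindex[OF f y0])
  also have "\<dots> = quad_form k (\<lambda>p q. a (f p) (f q)) x"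
    by (simp add: quad_form_def inner_fun_def apply_kernel_def z)
  finally have "quad_form n a y = quad_form k (\<lambda>p q. a (f p) (f q)) x" .
  moreover have "sqnorm n y = sqnorm k z"
    unfolding z_def by (rule sqnorm_reindex[OF f y0])
  moreover have "sqnorm k z = sqnorm k x"
    by (simp add: sqnorm_def z)
  ultimately show ?thesis using b[of y] by simp
qed

subsection \<open>Barriers of real-rooted polynomials and principal minors\<close>

text \<open>For \<open>c\<close> below the roots this is \<open>- p'(c) / p(c)\<close> with
  \<open>p = real_rooted E\<close>.\<close>

definition barrier :: "real multiset \<Rightarrow> real \<Rightarrow> real" where
  "barrier E c = (\<Sum>e\<in>#E. 1 / (e - c))"

text \<open>The factors are written \<open>e - c\<close>, positive for \<open>c\<close> below the
  roots, so that all signs sit in the power of \<open>- 1\<close>.\<close>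

lemma poly_real_rooted:
  "poly (real_rooted E) (of_real c) = of_real ((- 1) ^ size E * (\<Prod>e\<in>#E. e - c))"
  by (induction E) (auto simp: real_rooted_def algebra_simps)

lemma poly_pderiv_real_rooted:
  assumes "\<And>e. e \<in># E \<Longrightarrow> c < e"
  shows "poly (pderiv (real_rooted E)) (of_real c) =
    of_real (- ((- 1) ^ size E * (\<Prod>e\<in>#E. e - c) * barrier E c))"
  using assms
proof (induction E)
  case empty
  then show ?case by (simp add: real_rooted_def barrier_def)
next
  case (add e E)
  have e: "c < e" and E: "\<And>e. e \<in># E \<Longrightarrow> c < e" using add.prems by auto
  have eq: "real_rooted (add_mset e E) = [:- complex_of_real e, 1:] * real_rooted E"
    by (simp add: real_rooted_def)
  have b: "barrier (add_mset e E) c = 1 / (e - c) + barrier E c" by (simp add: barrier_def)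
  have "poly (pderiv (real_rooted (add_mset e E))) (of_real c) =
      poly (real_rooted E) (of_real c) + (of_real c - of_real e) * poly (pderiv (real_rooted E)) (of_real c)"
    unfolding eq pderiv_mult by (simp add: pderiv_pCons left_diff_distrib)
  also have "\<dots> = of_real ((- 1) ^ size E * (\<Prod>e\<in>#E. e - c)
      + (c - e) * - ((- 1) ^ size E * (\<Prod>e\<in>#E. e - c) * barrier E c))"
    by (simp only: add.IH[OF E] poly_real_rooted of_real_add of_real_mult of_real_diff)
  also have "(- 1) ^ size E * (\<Prod>e\<in>#E. e - c)
      + (c - e) * - ((- 1) ^ size E * (\<Prod>e\<in>#E. e - c) * barrier E c) =
      - ((- 1) ^ size (add_mset e E) * (\<Prod>e\<in>#add_mset e E. e - c) * barrier (add_mset e E) c)"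
    using e by (simp add: b field_simps)
  finally show ?case .
qed

text \<open>The identity \<open>p'' / p = (p' / p)^2 + (p' / p)'\<close> in terms of the roots,
  proved by adding one root at a time.\<close>

lemma poly_pderiv2_real_rooted:
  assumes "\<And>e. e \<in># E \<Longrightarrow> c < e"
  shows "poly (pderiv (pderiv (real_rooted E))) (of_real c) =
    of_real ((- 1) ^ size E * (\<Prod>e\<in>#E. e - c) * ((barrier E c)\<^sup>2 - (\<Sum>e\<in>#E. 1 / (e - c)\<^sup>2)))"
  using assms
proof (induction E)
  case empty
  then show ?case by (simp add: real_rooted_def barrier_def)
next
  case (add e E)
  have e: "c < e" and E: "\<And>e. e \<in># E \<Longrightarrow> c < e" using add.prems by auto
  have eq: "real_rooted (add_mset e E) = [:- complex_of_real e, 1:] * real_rooted E"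
    by (simp add: real_rooted_def)
  have b: "barrier (add_mset e E) c = 1 / (e - c) + barrier E c" by (simp add: barrier_def)
  define P where "P = (- 1) ^ size E * (\<Prod>e\<in>#E. e - c)"
  define S where "S = (\<Sum>e\<in>#E. 1 / (e - c)\<^sup>2)"
  have "poly (pderiv (pderiv (real_rooted (add_mset e E)))) (of_real c) =
      2 * poly (pderiv (real_rooted E)) (of_real c)
      + (of_real c - of_real e) * poly (pderiv (pderiv (real_rooted E))) (of_real c)"
    unfolding eq pderiv_mult pderiv_add
    by (simp add: pderiv_pCons pderiv_mult pderiv_add left_diff_distrib)
  also have "\<dots> = of_real (2 * - (P * barrier E c) + (c - e) * (P * ((barrier E c)\<^sup>2 - S)))"
    unfolding P_def S_def
    by (simp only: add.IH[OF E] poly_pderiv_real_rooted[OF E] of_real_add of_real_mult of_real_diff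
        of_real_numeral)
  also have "2 * - (P * barrier E c) + (c - e) * (P * ((barrier E c)\<^sup>2 - S)) =
      - (P * (e - c)) * ((1 / (e - c) + barrier E c)\<^sup>2 - (1 / (e - c)\<^sup>2 + S))"
  proof -
    define u where "u = e - c"
    have u: "u > 0" "c - e = - u" using e by (auto simp: u_def)
    show ?thesis unfolding u(2) u_def[symmetric] using u(1)
      by (simp add: power2_sum power_divide algebra_simps)
  qed
  also have "\<dots> = (- 1) ^ size (add_mset e E) * (\<Prod>e\<in>#add_mset e E. e - c) *
      ((barrier (add_mset e E) c)\<^sup>2 - (\<Sum>e\<in>#add_mset e E. 1 / (e - c)\<^sup>2))"
    by (simp add: b P_def S_def)
  finally show ?case .
qed

text \<open>One shape for all linear combinations: longer ones nest inside \<open>g\<close>, and a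
  single term is padded with \<open>+ 0\<close>, so that rewriting evaluates them.\<close>

lemma sum_mset_linear_combination:
  fixes f g :: "'a \<Rightarrow> real"
  shows "(\<Sum>e\<in>#E. r * f e + g e) = r * (\<Sum>e\<in>#E. f e) + (\<Sum>e\<in>#E. g e)"
  by (induction E) (auto simp: algebra_simps)

text \<open>In effect, the barrier of the derivative of \<open>real_rooted E\<close> at
  \<open>c'\<close> is at most \<open>\<phi>\<close>. With \<open>y = 1 / (e - c')\<close> one has
  \<open>1 / (e - c) = \<phi> y / (\<phi> + y)\<close>, so the hypothesis says that the
  \<open>y / (\<phi> + y)\<close> sum to at most \<open>1\<close>. Cauchy--Schwarz with the weights
  \<open>y / (\<phi> + y)\<close> and \<open>y (\<phi> + y)\<close> then bounds the square of the
  sum of the \<open>y\<close>.\<close>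

lemma barrier_shift_ineq:
  assumes phi: "\<phi> > 0" and E: "\<And>e. e \<in># E \<Longrightarrow> c + 1 / \<phi> < e" and b: "barrier E c \<le> \<phi>"
  defines "c' \<equiv> c + 1 / \<phi>"
  shows "(barrier E c')\<^sup>2 - (\<Sum>e\<in>#E. 1 / (e - c')\<^sup>2) \<le> \<phi> * barrier E c'"
proof -
  define Y where "Y = barrier E c'"
  have pt: "2 * Y * (1 / (e - c')) \<le> Y\<^sup>2 / \<phi> * (1 / (e - c)) + (\<phi> * (1 / (e - c')) + 1 / (e - c')\<^sup>2)"
    if "e \<in># E" for e
  proof -
    define y where "y = 1 / (e - c')"
    have "e - c' > 0" using E[OF that] by (simp add: c'_def)
    then have y: "y > 0" by (simp add: y_def)
    have "e - c = 1 / y + 1 / \<phi>" using \<open>e - c' > 0\<close> by (simp add: y_def c'_def)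
    then have x: "1 / (e - c) = \<phi> * y / (\<phi> + y)"
      using y phi by (simp add: add_divide_eq_iff divide_add_eq_iff add.commute)
    \<comment> \<open>Cauchy--Schwarz in pointwise form: a completed square with the total
      \<open>Y\<close> as multiplier, ready to be summed over \<open>E\<close>.\<close>
    have "0 \<le> y / (\<phi> + y) * (Y - (\<phi> + y))\<^sup>2" using y phi by simp
    also have "\<dots> = Y\<^sup>2 * (y / (\<phi> + y)) - 2 * Y * y + y * (\<phi> + y)"
      using y phi by (simp add: field_simps power2_eq_square)
    also have "Y\<^sup>2 * (y / (\<phi> + y)) = Y\<^sup>2 / \<phi> * (1 / (e - c))"
      unfolding x using phi by simp
    finally have "2 * Y * y \<le> Y\<^sup>2 / \<phi> * (1 / (e - c)) + (\<phi> * y + y\<^sup>2)"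
      by (simp add: power2_eq_square algebra_simps)
    then show ?thesis by (simp add: y_def power_divide)
  qed
  have "2 * Y * barrier E c' + 0 = (\<Sum>e\<in>#E. 2 * Y * (1 / (e - c')) + 0)"
    by (simp only: sum_mset_linear_combination barrier_def sum_mset.neutral_const)
  also have "\<dots> \<le> (\<Sum>e\<in>#E. Y\<^sup>2 / \<phi> * (1 / (e - c)) + (\<phi> * (1 / (e - c')) + 1 / (e - c')\<^sup>2))"
    using pt by (intro sum_mset_mono) simp
  also have "\<dots> = Y\<^sup>2 / \<phi> * barrier E c + (\<phi> * barrier E c' + (\<Sum>e\<in>#E. 1 / (e - c')\<^sup>2))"
    by (simp only: sum_mset_linear_combination barrier_def)
  also have "Y\<^sup>2 / \<phi> * barrier E c \<le> Y\<^sup>2 / \<phi> * \<phi>"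
    using b phi by (intro mult_left_mono) auto
  finally have "2 * Y * Y \<le> Y\<^sup>2 + (\<phi> * Y + (\<Sum>e\<in>#E. 1 / (e - c')\<^sup>2))"
    using phi unfolding Y_def[symmetric] by simp
  then show ?thesis unfolding Y_def[symmetric] by (simp add: power2_eq_square)
qed

text \<open>All terms of the barrier are positive. When the barrier is at most
  \<open>\<phi>\<close>, this gives \<open>c + 1 / \<phi> \<le> e\<close>, strictly as soon as there
  is a second root.\<close>

lemma barrier_ge_term:
  assumes "\<And>e. e \<in># E \<Longrightarrow> c < e" "e \<in># E"
  shows "1 / (e - c) \<le> barrier E c" "size E \<ge> 2 \<Longrightarrow> 1 / (e - c) < barrier E c"
proof -
  obtain F where F: "E = add_mset e F" using assms(2) by (meson multi_member_split)
  have nn: "0 \<le> 1 / (x - c)" if "x \<in># F" for x using assms(1)[of x] that by (simp add: F)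
  have eq: "barrier E c = 1 / (e - c) + barrier F c" by (simp add: F barrier_def)
  have "0 \<le> barrier F c"
    using nn sum_mset_mono[of F "\<lambda>_. 0" "\<lambda>x. 1 / (x - c)"] by (simp add: barrier_def)
  then show "1 / (e - c) \<le> barrier E c" using eq by simp
  assume "size E \<ge> 2"
  then have "F \<noteq> {#}" using F by auto
  then obtain x G where G: "F = add_mset x G" by (meson multiset_cases)
  have "0 \<le> barrier G c"
    using nn sum_mset_mono[of G "\<lambda>_. 0" "\<lambda>x. 1 / (x - c)"] by (simp add: barrier_def G)
  moreover have "0 < 1 / (x - c)" using assms(1)[of x] by (simp add: F G)
  ultimately have "0 < barrier F c" by (simp add: G barrier_def add_pos_nonneg)
  then show "1 / (e - c) < barrier E c" using eq by simp
qed

lemma prod_mset_diff_pos: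
  fixes E :: "real multiset"
  shows "(\<And>e. e \<in># E \<Longrightarrow> c < e) \<Longrightarrow> 0 < (\<Prod>e\<in>#E. e - c)"
  by (induction E) auto

lemma mat_delete_kernel_mat:
  "i < Suc n \<Longrightarrow> mat_delete (kernel_mat (Suc n) a) i i =
    kernel_mat n (\<lambda>p q. a (insert_index i p) (insert_index i q))"
  unfolding mat_delete_def kernel_mat_def insert_index_def by (rule eq_matI) auto

lemma hermitian_kernel_comp: "hermitian_kernel a \<Longrightarrow> hermitian_kernel (\<lambda>p q. a (f p) (f q))"
  unfolding hermitian_kernel_def by blast

text \<open>The derivative of the characteristic polynomial is the sum of those of the principal
  minors, so the barrier of the derivative is a weighted average of the barriers of the minors.\<close>

lemma exists_principal_minor:
  assumes a: "hermitian_kernel a" and n: "n \<ge> 1" and phi: "\<phi> > 0"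
    and E: "char_poly (kernel_mat (Suc n) a) = real_rooted E" "size E = Suc n"
    and c: "\<And>e. e \<in># E \<Longrightarrow> c < e" and b: "barrier E c \<le> \<phi>"
  obtains i F where "i < Suc n"
    "char_poly (kernel_mat n (\<lambda>p q. a (insert_index i p) (insert_index i q))) = real_rooted F"
    "size F = n" "\<And>e. e \<in># F \<Longrightarrow> c + 1 / \<phi> < e" "barrier F (c + 1 / \<phi>) \<le> \<phi>"
proof -
  define c' where "c' = c + 1 / \<phi>"
  define m where "m = Min (set_mset E)"
  let ?k = "\<lambda>i p q. a (insert_index i p) (insert_index i q)"
  have ne: "set_mset E \<noteq> {}" using E(2) by auto
  \<comment> \<open>\<open>n \<ge> 1\<close> provides a second eigenvalue, so the shifted point
    stays strictly below the spectrum.\<close>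
  have E': "c' < e" if "e \<in># E" for e
  proof -
    have "1 / (e - c) < \<phi>" using barrier_ge_term(2)[OF c that] b E(2) n by linarith
    moreover have "0 < e - c" using c[OF that] by simp
    ultimately show ?thesis using phi by (simp add: c'_def field_simps)
  qed
  then have m: "c' < m" using ne by (simp add: m_def)
  \<comment> \<open>The minors inherit the least eigenvalue \<open>m\<close> as a lower bound, so
    \<open>c'\<close> lies below their spectra too.\<close>
  have "m * sqnorm (Suc n) x \<le> quad_form (Suc n) a x" for x
    by (rule quad_form_ge[OF a]) (simp add: eigenvalue_iff_mem[OF E(1)] m_def)
  then have minor: "m * sqnorm n x \<le> quad_form n (?k i) x" if "i < Suc n" for i x
    by (rule quad_form_principal_ge[rotated 2])
      (use that insert_index_inj_on[of i "{..<n}"] in \<open>auto simp: insert_index_def\<close>)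
  have "\<exists>F. char_poly (kernel_mat n (?k i)) = real_rooted F \<and> size F = n" for i
    using hermitian_char_poly[OF hermitian_kernel_comp[OF a, of "insert_index i"]] by metis
  then obtain F where F: "\<And>i. char_poly (kernel_mat n (?k i)) = real_rooted (F i)"
    "\<And>i. size (F i) = n" by metis
  have F': "c' < e" if i: "i < Suc n" and e: "e \<in># F i" for i e
  proof -
    have "eigenvalue (kernel_mat n (?k i)) (of_real e)" using e by (simp add: eigenvalue_iff_mem[OF F(1)])
    then obtain x where x: "sqnorm n x > 0" "complex_of_real e = of_real (quad_form n (?k i) x / sqnorm n x)"
      by (rule hermitian_eigenvalue[OF hermitian_kernel_comp[OF a, of "insert_index i"]])
    have "e = quad_form n (?k i) x / sqnorm n x" using x(2) of_real_eq_iff by blast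
    then have "m \<le> e" using minor[OF i, of x] x(1) by (simp add: pos_le_divide_eq)
    then show ?thesis using m by simp
  qed
  have der: "pderiv (real_rooted E) = (\<Sum>i<Suc n. real_rooted (F i))"
    unfolding E(1)[symmetric] pderiv_char_poly[OF kernel_mat_carrier]
    by (intro sum.cong refl) (simp add: mat_delete_kernel_mat F(1))
  \<comment> \<open>Up to a common sign, \<open>W i\<close> is the characteristic polynomial of the
    \<open>i\<close>-th minor at \<open>c'\<close>. The first derivative of
    \<open>real_rooted E\<close> there gives the sum of these weights, the second the weighted sum
    of the barriers.\<close>
  define W where "W = (\<lambda>i. \<Prod>e\<in>#F i. e - c')"
  have W: "W i > 0" if "i < Suc n" for i
    unfolding W_def by (rule prod_mset_diff_pos) (rule F'[OF that])
  define P where "P = (\<Prod>e\<in>#E. e - c')"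
  have P: "P > 0" unfolding P_def by (rule prod_mset_diff_pos) (rule E')
  have "complex_of_real ((- 1) ^ n * (P * barrier E c')) = poly (pderiv (real_rooted E)) (of_real c')"
    by (subst poly_pderiv_real_rooted[OF E']) (auto simp: E(2) P_def)
  also have "\<dots> = of_real ((- 1) ^ n * (\<Sum>i<Suc n. W i))"
    unfolding der poly_sum poly_real_rooted F(2) of_real_sum[symmetric] sum_distrib_left W_def ..
  finally have sum1: "P * barrier E c' = (\<Sum>i<Suc n. W i)"
    by (simp only: of_real_eq_iff) simp
  have "complex_of_real (- ((- 1) ^ n * (P * ((barrier E c')\<^sup>2 - (\<Sum>e\<in>#E. 1 / (e - c')\<^sup>2)))))
      = poly (pderiv (pderiv (real_rooted E))) (of_real c')"
    by (subst poly_pderiv2_real_rooted[OF E']) (auto simp: E(2) P_def)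
  also have "\<dots> = (\<Sum>i<Suc n. poly (pderiv (real_rooted (F i))) (of_real c'))"
    by (simp only: der pderiv_sum poly_sum)
  also have "\<dots> = (\<Sum>i<Suc n. of_real (- ((- 1) ^ n * (W i * barrier (F i) c'))))"
    by (intro sum.cong refl, subst poly_pderiv_real_rooted) (auto simp: F' F(2) W_def)
  also have "\<dots> = of_real (- ((- 1) ^ n * (\<Sum>i<Suc n. W i * barrier (F i) c')))"
    unfolding of_real_sum[symmetric] sum_distrib_left sum_negf ..
  finally have sum2: "P * ((barrier E c')\<^sup>2 - (\<Sum>e\<in>#E. 1 / (e - c')\<^sup>2)) = (\<Sum>i<Suc n. W i * barrier (F i) c')"
    by (simp only: of_real_eq_iff) simp
  \<comment> \<open>If every minor had a barrier above \<open>\<phi>\<close>, so would their average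
    with weights \<open>W\<close>, against \<open>barrier_shift_ineq\<close> multiplied by
    \<open>P\<close>.\<close>
  have "\<exists>i<Suc n. barrier (F i) c' \<le> \<phi>"
  proof (rule ccontr)
    assume "\<not> ?thesis"
    then have "(\<Sum>i<Suc n. W i * \<phi>) < (\<Sum>i<Suc n. W i * barrier (F i) c')"
      using W by (intro sum_strict_mono mult_strict_left_mono) (auto simp: not_le)
    also have "\<dots> \<le> P * (\<phi> * barrier E c')"
      unfolding sum2[symmetric] using P E'
      by (intro mult_left_mono barrier_shift_ineq[OF phi _ b, folded c'_def]) simp_all
    also have "\<dots> = (\<Sum>i<Suc n. W i * \<phi>)"
      by (simp add: sum_distrib_right[symmetric] sum1[symmetric] del: sum.lessThan_Suc)
    finally show False by simp
  qed
  then show ?thesis using that F F' unfolding c'_def by blast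
qed

text \<open>Each of the \<open>d\<close> deletions raises the point by \<open>1 / \<phi>\<close>.
  Afterwards the barrier is still at most \<open>\<phi>\<close>, so the spectrum starts no lower
  than a further \<open>1 / \<phi>\<close> up; hence \<open>Suc d\<close>. As
  \<open>k \<ge> 1\<close>, at least two eigenvalues are present before every deletion.\<close>

lemma exists_principal_submatrix:
  assumes a: "hermitian_kernel a" and k: "k \<ge> 1" and phi: "\<phi> > 0"
    and E: "char_poly (kernel_mat (k + d) a) = real_rooted E" "size E = k + d"
    and c: "\<And>e. e \<in># E \<Longrightarrow> c < e" and b: "barrier E c \<le> \<phi>"
  shows "\<exists>f. inj_on f {..<k} \<and> f ` {..<k} \<subseteq> {..<k + d} \<and>
    (\<forall>x. (c + real (Suc d) / \<phi>) * sqnorm k x \<le> quad_form k (\<lambda>p q. a (f p) (f q)) x)"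
  using a E c b
proof (induction d arbitrary: a E c)
  case 0
  have "(c + 1 / \<phi>) * sqnorm k x \<le> quad_form k a x" for x
  proof (rule quad_form_ge[OF 0(1)])
    fix e assume "eigenvalue (kernel_mat k a) (complex_of_real e)"
    then have e: "e \<in># E" using eigenvalue_iff_mem[of k a E] 0 by simp
    have "1 / (e - c) \<le> \<phi>" using barrier_ge_term(1)[OF 0(4) e] 0(5) by simp
    moreover have "0 < e - c" using 0(4)[OF e] by simp
    ultimately show "c + 1 / \<phi> \<le> e" using phi by (simp add: field_simps)
  qed
  then show ?case by (intro exI[of _ id]) auto
next
  case (Suc d)
  obtain i F where i: "i < Suc (k + d)" and
    F: "char_poly (kernel_mat (k + d) (\<lambda>p q. a (insert_index i p) (insert_index i q))) = real_rooted F"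
    "size F = k + d" "\<And>e. e \<in># F \<Longrightarrow> c + 1 / \<phi> < e" "barrier F (c + 1 / \<phi>) \<le> \<phi>"
    using exists_principal_minor[OF Suc.prems(1), of "k + d" \<phi> E c] Suc.prems k phi
    by (metis add_Suc_right trans_le_add1)
  obtain f where f: "inj_on f {..<k}" "f ` {..<k} \<subseteq> {..<k + d}"
    "\<And>x. (c + 1 / \<phi> + real (Suc d) / \<phi>) * sqnorm k x \<le>
      quad_form k (\<lambda>p q. a (insert_index i (f p)) (insert_index i (f q))) x"
    using Suc.IH[OF hermitian_kernel_comp[OF Suc.prems(1), of "insert_index i"] F] by blast
  have "c + 1 / \<phi> + real (Suc d) / \<phi> = c + real (Suc (Suc d)) / \<phi>"
    by (simp add: add_divide_distrib)
  then have "(c + real (Suc (Suc d)) / \<phi>) * sqnorm k x \<le>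
      quad_form k (\<lambda>p q. a ((insert_index i \<circ> f) p) ((insert_index i \<circ> f) q)) x" for x
    using f(3)[of x] by (simp only: o_apply)
  moreover have "inj_on (insert_index i \<circ> f) {..<k}"
    using f(1) insert_index_inj_on by (intro comp_inj_on)
  moreover have "(insert_index i \<circ> f) ` {..<k} \<subseteq> {..<k + Suc d}"
    using f(2) by (force simp: insert_index_def)
  ultimately show ?case by (intro exI[of _ "insert_index i \<circ> f"]) blast
qed

subsection \<open>Optimising the barrier\<close>

text \<open>Cauchy--Schwarz, by summing \<open>2 t e \<le> e^2 + t^2\<close> with \<open>t\<close>
  the mean.\<close>

lemma sum_mset_square_le:
  fixes E :: "real multiset"
  shows "(\<Sum>e\<in>#E. e)\<^sup>2 \<le> real (size E) * (\<Sum>e\<in>#E. e\<^sup>2)"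
proof (cases "E = {#}")
  case False
  define m where "m = real (size E)"
  have m: "m > 0" using False by (simp add: m_def nonempty_has_size)
  define S where "S = (\<Sum>e\<in>#E. e)"
  define t where "t = S / m"
  have "(\<Sum>e\<in>#E. 2 * t * e + 0) \<le> (\<Sum>e\<in>#E. 1 * e\<^sup>2 + t\<^sup>2)"
    by (rule sum_mset_mono) (use sum_squares_bound[of t] in \<open>simp add: add.commute\<close>)
  then have "2 * t * S + 0 \<le> 1 * (\<Sum>e\<in>#E. e\<^sup>2) + m * t\<^sup>2"
    unfolding sum_mset_linear_combination S_def[symmetric] by (simp add: m_def)
  moreover have "S = m * t" using m by (simp add: t_def)
  ultimately have "m * (m * t\<^sup>2) \<le> m * (\<Sum>e\<in>#E. e\<^sup>2)"
    using m by (intro mult_left_mono) (auto simp: power2_eq_square algebra_simps)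
  moreover have "m * (m * t\<^sup>2) = S\<^sup>2"
    using m by (simp add: t_def power2_eq_square)
  ultimately show ?thesis by (simp add: m_def S_def)
qed simp

text \<open>Here \<open>1 / (x + t)\<close> is bounded by the quadratic polynomial that interpolates it at \<open>0\<close>
  and, to second order, at \<open>\<mu>\<close>.\<close>

lemma barrier_le_moments:
  assumes t: "t > 0" and E: "\<And>e. e \<in># E \<Longrightarrow> 0 \<le> e" and M: "(\<Sum>e\<in>#E. e) > 0"
    and mu: "\<mu> = (\<Sum>e\<in>#E. e\<^sup>2) / (\<Sum>e\<in>#E. e)"
  shows "barrier E (- t) \<le> real (size E) / t - (\<Sum>e\<in>#E. e) / (t * (\<mu> + t))"
proof -
  \<comment> \<open>\<open>b\<close> and \<open>a\<close> are the coefficients of the interpolating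
    quadratic \<open>b x^2 + a x + 1 / t\<close>, fixed by value and slope at
    \<open>\<mu>\<close>.\<close>
  define b where "b = 1 / (t * (\<mu> + t)\<^sup>2)"
  define S where "S = (\<Sum>e\<in>#E. e)"
  define a where "a = - (1 / (t * (\<mu> + t))) - \<mu> * b"
  have "0 \<le> (\<Sum>e\<in>#E. e\<^sup>2)" using sum_mset_mono[of E "\<lambda>_. 0" "\<lambda>e. e\<^sup>2"] by simp
  then have mu0: "\<mu> \<ge> 0" unfolding mu using M by simp
  have pt: "1 / (x - (- t)) \<le> b * x\<^sup>2 + (a * x + 1 / t)" if "x \<in># E" for x
  proof -
    have x: "x \<ge> 0" by (rule E[OF that])
    have pos: "t \<noteq> 0" "\<mu> + t \<noteq> 0" "x + t \<noteq> 0" using t mu0 x by auto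
    define w z where "w = \<mu> + t" and "z = x + t"
    \<comment> \<open>The interpolation error in closed form, nonnegative for
      \<open>x \<ge> 0\<close>.\<close>
    have "0 \<le> x * (z - w)\<^sup>2 / (t * z * w\<^sup>2)" using t x mu0 by (simp add: w_def z_def)
    also have "\<dots> = b * x\<^sup>2 + (a * x + 1 / t) - 1 / z"
    proof -
      have xz: "x = z - t" "\<mu> = w - t" by (simp_all add: w_def z_def)
      have nz: "t \<noteq> 0" "w \<noteq> 0" "z \<noteq> 0" using pos by (simp_all add: w_def z_def)
      show ?thesis unfolding a_def b_def w_def[symmetric] unfolding xz using nz
        by (simp add: field_simps power2_eq_square)
    qed
    finally show ?thesis by (simp add: z_def)
  qed
  have "barrier E (- t) \<le> (\<Sum>e\<in>#E. b * e\<^sup>2 + (a * e + 1 / t))"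
    unfolding barrier_def by (rule sum_mset_mono) (rule pt)
  also have "\<dots> = b * (\<Sum>e\<in>#E. e\<^sup>2) + (a * (\<Sum>e\<in>#E. e) + real (size E) / t)"
    by (simp only: sum_mset_linear_combination) simp
  \<comment> \<open>By the choice of \<open>\<mu>\<close> the second moment is \<open>\<mu>\<close>
    times the first, and \<open>a + \<mu> b\<close> collapses to
    \<open>- 1 / (t (\<mu> + t))\<close>.\<close>
  also have "(\<Sum>e\<in>#E. e\<^sup>2) = \<mu> * (\<Sum>e\<in>#E. e)"
    unfolding mu using M by (simp only: nonzero_eq_divide_eq times_divide_eq_left)
  finally have "barrier E (- t) \<le> b * (\<mu> * S) + (a * S + real (size E) / t)"
    by (simp only: S_def)
  also have "\<dots> = real (size E) / t - S / (t * (\<mu> + t))"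
    by (simp add: a_def algebra_simps)
  finally show ?thesis by (simp only: S_def)
qed

text \<open>With \<open>s = t / \<mu>\<close> and \<open>\<rho>\<close> the fraction of eigenvalues
  equal to \<open>\<mu>\<close> in the extremal spectrum, the left-hand side is
  \<open>- t + (m - k) / \<phi>\<close> in units of \<open>\<mu>\<close>.\<close>

lemma optimal_shift:
  fixes c \<rho> :: real
  assumes c: "0 < c" "c < \<rho>" and rho: "\<rho> < 1"
  obtains s where "s > 0"
    "(1 - c) * (s * (1 + s)) / (s + 1 - \<rho>) - s = (sqrt (\<rho> * (1 - c)) - sqrt (c * (1 - \<rho>)))\<^sup>2"
proof -
  define p q where "p = sqrt (\<rho> * (1 - c))" and "q = sqrt (c * (1 - \<rho>))"
  have p2: "p * p = \<rho> * (1 - c)" and q2: "q * q = c * (1 - \<rho>)"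
    using c rho by (auto simp: p_def q_def)
  have q: "q > 0" using c rho by (simp add: q_def)
  have pq: "p > q" unfolding p_def q_def using c by (simp add: algebra_simps)
  \<comment> \<open>In \<open>u = s + 1 - \<rho>\<close> the left-hand side is a constant minus
    \<open>c u\<close> minus a positive multiple of \<open>1 / u\<close>. This \<open>s\<close> puts
    \<open>u\<close> at the maximiser \<open>p q / c\<close>; it is positive because
    \<open>c < \<rho>\<close> makes \<open>q < p\<close>.\<close>
  define s where "s = q * (p - q) / c"
  have s: "s > 0" using q pq c by (simp add: s_def)
  have r: "1 - \<rho> = q * q / c" using q2 c by (simp add: field_simps)
  have u: "s + (1 - \<rho>) = p * q / c"
    unfolding r s_def using c by (simp add: field_simps)
  have "(1 - c) * (1 + s) - (s + (1 - \<rho>)) = p * p - c * (s + (1 - \<rho>))"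
    unfolding p2 by (simp add: algebra_simps)
  also have "\<dots> = p * (p - q)" unfolding u using c by (simp add: algebra_simps)
  finally have v: "(1 - c) * (1 + s) - p * q / c = p * (p - q)" unfolding u .
  have pq0: "p * q / c \<noteq> 0" using pq q c by simp
  have "(1 - c) * (s * (1 + s)) / (p * q / c) - s = s * ((1 - c) * (1 + s) - p * q / c) / (p * q / c)"
    using pq0 by (simp add: diff_divide_distrib right_diff_distrib mult_ac)
  also have "\<dots> = (p - q)\<^sup>2"
    unfolding v unfolding s_def using pq q c by (simp add: power2_eq_square)
  finally have "(1 - c) * (s * (1 + s)) / (s + 1 - \<rho>) - s = (p - q)\<^sup>2"
    unfolding u[symmetric] by (simp add: add_diff_eq)
  then show thesis using that s unfolding p_def q_def by blast
qed

text \<open>Supplies starting point and barrier level for the deletions; the last right-hand side is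
  the eigenvalue bound they yield when \<open>k\<close> indices remain.\<close>

lemma barrier_bound_exists:
  fixes E :: "real multiset" and k m :: nat
  assumes E: "\<And>e. e \<in># E \<Longrightarrow> 0 \<le> e" and m: "size E = m" and k: "1 \<le> k" "k \<le> m"
    and M: "(\<Sum>e\<in>#E. e) > 0"
    and delta: "\<delta> < 1" "\<delta> * ((\<Sum>e\<in>#E. e)\<^sup>2 / (\<Sum>e\<in>#E. e\<^sup>2)) = real k"
  defines "c \<equiv> real k / real m"
  obtains t \<phi> where "t > 0" "\<phi> > 0" "barrier E (- t) \<le> \<phi>"
    "(\<Sum>e\<in>#E. e) / real m * (sqrt (1 - c) - sqrt (\<delta> - c))\<^sup>2 \<le> - t + real (Suc (m - k)) / \<phi>"
proof -
  define M1 M2 where "M1 = (\<Sum>e\<in>#E. e)" and "M2 = (\<Sum>e\<in>#E. e\<^sup>2)"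
  define m' where "m' = real m"
  define k' where "k' = real k"
  have m0: "m' > 0" and k0: "k' \<ge> 1" and km: "real (Suc (m - k)) = m' - k' + 1"
    using k by (auto simp: m'_def k'_def)
  have M1: "M1 > 0" using M by (simp add: M1_def)
  have dk: "\<delta> * (M1\<^sup>2 / M2) = k'" using delta(2) by (simp add: M1_def M2_def k'_def)
  have "M2 \<ge> 0" unfolding M2_def using sum_mset_mono[of E "\<lambda>_. 0" "\<lambda>e. e\<^sup>2"] by simp
  moreover have "M2 \<noteq> 0" using dk k0 by auto
  ultimately have M2: "M2 > 0" by simp
  \<comment> \<open>\<open>\<rho> m'\<close> is the stable rank \<open>M1^2 / M2\<close>, formally
    the number of eigenvalues \<open>\<mu>\<close> in the extremal spectrum.\<close>
  define \<rho> where "\<rho> = M1\<^sup>2 / M2 / m'"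
  define \<mu> where "\<mu> = M2 / M1"
  have mu: "\<mu> > 0" using M1 M2 by (simp add: \<mu>_def)
  have rho0: "\<rho> > 0" using M1 M2 m0 by (simp add: \<rho>_def)
  have "M1\<^sup>2 \<le> m' * M2"
    using sum_mset_square_le[of E] by (simp add: M1_def M2_def m'_def m)
  then have rho1: "\<rho> \<le> 1" using M2 m0 by (simp add: \<rho>_def pos_divide_le_eq mult.commute)
  have c: "c = k' / m'" by (simp add: c_def k'_def m'_def)
  then have c0: "c > 0" using k0 m0 by simp
  have dc: "c = \<delta> * \<rho>" unfolding c dk[symmetric] by (simp add: \<rho>_def)
  have "\<delta> * \<rho> < \<rho>" using delta(1) rho0 by simp
  then have crho: "c < \<rho>" by (simp add: dc)
  have Mrho: "M1 = \<mu> * \<rho> * m'" using M1 M2 m0 by (simp add: \<mu>_def \<rho>_def power2_eq_square)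
  have bound: "barrier E (- t) \<le> m' / t - M1 / (t * (\<mu> + t))" if "t > 0" for t
    using barrier_le_moments[OF that E M refl] by (simp add: M1_def M2_def m'_def m \<mu>_def)
  show thesis
  proof (cases "\<rho> = 1")
    case True
    \<comment> \<open>The optimum is at \<open>t = 0\<close>, which is not admissible; at \<open>t = \<mu> / k\<close> the extra summand
      \<open>1 / \<phi>\<close> makes up for the loss.\<close>
    define t where "t = \<mu> / k'"
    have t: "t > 0" using mu k0 by (simp add: t_def)
    have "m' / t - M1 / (t * (\<mu> + t)) = m' / (\<mu> + t)"
    proof -
      define w where "w = \<mu> + t"
      have w: "w > 0" "\<mu> = w - t" using t mu by (simp_all add: w_def)
      show ?thesis
        unfolding w_def[symmetric] Mrho True unfolding w(2) using w(1) t by (simp add: field_simps)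
    qed
    then have "barrier E (- t) \<le> m' / (\<mu> + t)" using bound[OF t] by simp
    moreover have "m' / (\<mu> + t) > 0" using m0 mu t by simp
    moreover have "M1 / m' * (sqrt (1 - c) - sqrt (\<delta> - c))\<^sup>2 \<le> - t + (m' - k' + 1) / (m' / (\<mu> + t))"
    proof -
      \<comment> \<open>With \<open>\<rho> = 1\<close> one has \<open>\<delta> = c\<close>, so the
        second root vanishes.\<close>
      have "M1 / m' * (sqrt (1 - c) - sqrt (\<delta> - c))\<^sup>2 = \<mu> * (1 - c)"
        using crho True m0 dc by (simp add: Mrho)
      also have "\<dots> = \<mu> - \<mu> * k' / m'" by (simp add: c algebra_simps)
      also have "\<dots> \<le> \<mu> - \<mu> * k' / m' + \<mu> / (k' * m')" using mu k0 m0 by simp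
      also have "\<dots> = - t + (m' - k' + 1) / (m' / (\<mu> + t))"
        using k0 m0 by (simp add: t_def field_simps)
      finally show ?thesis .
    qed
    ultimately show ?thesis using that[OF t] unfolding km M1_def m'_def by blast
  next
    case False
    with rho1 have "\<rho> < 1" by simp
    then obtain s where s: "s > 0"
      "(1 - c) * (s * (1 + s)) / (s + 1 - \<rho>) - s = (sqrt (\<rho> * (1 - c)) - sqrt (c * (1 - \<rho>)))\<^sup>2"
      using optimal_shift[OF c0 crho] by blast
    define t where "t = \<mu> * s"
    \<comment> \<open>The value of the moment bound on the barrier at
      \<open>t = \<mu> s\<close>.\<close>
    define \<phi> where "\<phi> = m' / \<mu> * ((s + 1 - \<rho>) / (s * (1 + s)))"
    have t: "t > 0" using mu s by (simp add: t_def)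
    have phi: "\<phi> > 0" unfolding \<phi>_def using mu s(1) m0 \<open>\<rho> < 1\<close> by (intro mult_pos_pos divide_pos_pos) auto
    have "m' / t - M1 / (t * (\<mu> + t)) = \<phi>"
    proof -
      define w where "w = 1 + s"
      have w: "w > 0" "s + 1 - \<rho> = w - \<rho>" "\<mu> + t = \<mu> * w"
        using s(1) by (simp_all add: w_def t_def algebra_simps)
      show ?thesis
        unfolding w(3) unfolding \<phi>_def w(2) w_def[symmetric] Mrho t_def using mu s(1) w(1)
        by (simp add: field_simps)
    qed
    then have "barrier E (- t) \<le> \<phi>" using bound[OF t] by simp
    moreover have "M1 / m' * (sqrt (1 - c) - sqrt (\<delta> - c))\<^sup>2 \<le> - t + (m' - k' + 1) / \<phi>"
    proof -
      \<comment> \<open>Absorbing \<open>sqrt \<rho>\<close> into the two roots turns them into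
        those of \<open>optimal_shift\<close>.\<close>
      have e1: "\<rho> * (\<delta> - c) = c * (1 - \<rho>)" by (simp add: dc algebra_simps)
      have "M1 / m' * (sqrt (1 - c) - sqrt (\<delta> - c))\<^sup>2 = \<mu> * (sqrt \<rho> * sqrt (1 - c) - sqrt \<rho> * sqrt (\<delta> - c))\<^sup>2"
        using m0 rho0 by (simp add: Mrho right_diff_distrib[symmetric] power_mult_distrib)
      also have "\<dots> = \<mu> * ((1 - c) * (s * (1 + s)) / (s + 1 - \<rho>) - s)"
        unfolding real_sqrt_mult[symmetric] e1 s(2) ..
      also have "\<dots> = - t + (m' - k') / \<phi>"
      proof -
        have "m' - k' = m' * (1 - c)" using m0 by (simp add: c right_diff_distrib)
        define u z where "u = s + 1 - \<rho>" and "z = s * (1 + s)"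
        have "u > 0" "z > 0" using s(1) \<open>\<rho> < 1\<close> by (simp_all add: u_def z_def)
        then show ?thesis using m0 mu
          unfolding \<open>m' - k' = m' * (1 - c)\<close> \<phi>_def t_def u_def[symmetric] z_def[symmetric]
          by (simp add: field_simps)
      qed
      also have "\<dots> \<le> - t + (m' - k' + 1) / \<phi>" using phi by (simp add: divide_right_mono)
      finally show ?thesis .
    qed
    ultimately show ?thesis using that[OF t phi] unfolding km M1_def m'_def by blast
  qed
qed

subsection \<open>Restricted invertibility\<close>

definition gram_kernel :: "complex mat \<Rightarrow> nat \<Rightarrow> nat \<Rightarrow> complex" where
  "gram_kernel T = (\<lambda>i j. \<Sum>l<dim_row T. cnj (T $$ (l, i)) * T $$ (l, j))"

lemma hermitian_gram_kernel: "hermitian_kernel (gram_kernel T)"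
  by (simp add: hermitian_kernel_def gram_kernel_def mult.commute)

lemma adjoint_mult_self:
  assumes "T \<in> carrier_mat n m"
  shows "mat_adjoint T * T = kernel_mat m (gram_kernel T)"
  using assms unfolding mat_adjoint_def kernel_mat_def
  by (intro eq_matI)
    (auto simp: mat_of_rows_def scalar_prod_def gram_kernel_def lessThan_atLeast0)

lemma vnorm_squared: "v \<in> carrier_vec m \<Longrightarrow> (vnorm v)\<^sup>2 = sqnorm m (\<lambda>i. v $ i)"
  by (auto simp: vnorm_def L2_set_def sqnorm_def lessThan_atLeast0 sum_nonneg)

lemma vnorm_nonneg: "0 \<le> vnorm v"
  by (simp add: vnorm_def)

lemma quad_form_gram:
  assumes T: "T \<in> carrier_mat n m" and v: "v \<in> carrier_vec m"
  shows "quad_form m (gram_kernel T) (\<lambda>i. v $ i) = (vnorm (T *\<^sub>v v))\<^sup>2"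
proof -
  define y where "y = (\<lambda>l. \<Sum>j<m. T $$ (l, j) * v $ j)"
  have "inner_fun m (\<lambda>i. v $ i) (apply_kernel m (gram_kernel T) (\<lambda>i. v $ i)) =
      (\<Sum>i<m. \<Sum>j<m. \<Sum>l<n. cnj (v $ i) * (cnj (T $$ (l, i)) * T $$ (l, j) * v $ j))"
    using T by (simp add: inner_fun_def apply_kernel_def gram_kernel_def sum_distrib_left sum_distrib_right)
  also have "\<dots> = (\<Sum>i<m. \<Sum>l<n. \<Sum>j<m. cnj (v $ i) * (cnj (T $$ (l, i)) * T $$ (l, j) * v $ j))"
    by (intro sum.cong refl sum.swap)
  also have "\<dots> = (\<Sum>l<n. \<Sum>i<m. \<Sum>j<m. cnj (v $ i) * (cnj (T $$ (l, i)) * T $$ (l, j) * v $ j))"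
    by (rule sum.swap)
  also have "\<dots> = inner_fun n y y"
    unfolding inner_fun_def y_def cnj_sum sum_product by (simp add: mult_ac)
  finally have "quad_form m (gram_kernel T) (\<lambda>i. v $ i) = sqnorm n y"
    by (simp add: quad_form_def inner_fun_self)
  also have "\<dots> = sqnorm n (\<lambda>i. (T *\<^sub>v v) $ i)"
    unfolding sqnorm_def using T v
    by (intro sum.cong refl) (auto simp: y_def scalar_prod_def lessThan_atLeast0)
  also have "\<dots> = (vnorm (T *\<^sub>v v))\<^sup>2"
    using T v by (simp add: vnorm_squared[of _ n])
  finally show ?thesis .
qed

section \<open>Coordinate subspaces, the smallest singular value and the spectrum of the Gram
  kernel\<close>

lemma coord_subspace_iff:
  "v \<in> coord_subspace m \<sigma> \<longleftrightarrow> v \<in> carrier_vec m \<and> (\<forall>i<m. i \<notin> \<sigma> \<longrightarrow> v $ i = 0)"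
proof -
  have P: "coord_proj m \<sigma> *\<^sub>v w = vec m (\<lambda>i. if i \<in> \<sigma> then w $ i else 0)" if "w \<in> carrier_vec m" for w
  proof (rule eq_vecI)
    fix i assume "i < dim_vec (vec m (\<lambda>i. if i \<in> \<sigma> then w $ i else 0))"
    then have i: "i < m" by simp
    have "(coord_proj m \<sigma> *\<^sub>v w) $ i = (\<Sum>j<m. (if i = j \<and> i \<in> \<sigma> then 1 else 0) * w $ j)"
      using i that by (simp add: coord_proj_def scalar_prod_def lessThan_atLeast0)
    also have "\<dots> = (\<Sum>j<m. if j = i then (if i \<in> \<sigma> then w $ i else 0) else 0)"
      by (intro sum.cong) auto
    finally show "(coord_proj m \<sigma> *\<^sub>v w) $ i = vec m (\<lambda>i. if i \<in> \<sigma> then w $ i else 0) $ i"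
      using i by simp
  qed (simp add: coord_proj_def)
  show ?thesis
  proof
    assume "v \<in> coord_subspace m \<sigma>"
    then show "v \<in> carrier_vec m \<and> (\<forall>i<m. i \<notin> \<sigma> \<longrightarrow> v $ i = 0)"
      by (auto simp: coord_subspace_def P)
  next
    assume v: "v \<in> carrier_vec m \<and> (\<forall>i<m. i \<notin> \<sigma> \<longrightarrow> v $ i = 0)"
    then have "coord_proj m \<sigma> *\<^sub>v v = v"
      by (simp add: P) (rule eq_vecI, auto)
    with v show "v \<in> coord_subspace m \<sigma>" unfolding coord_subspace_def by (metis image_eqI)
  qed
qed

text \<open>The index \<open>i\<close> supplies a unit vector; without one the infimum would be over
  the empty set.\<close>

lemma s_min_ge:
  assumes i: "i \<in> \<sigma>" "i < m"
    and b: "\<And>v. v \<in> coord_subspace m \<sigma> \<Longrightarrow> vnorm v = 1 \<Longrightarrow> b \<le> vnorm (T *\<^sub>v v)"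
  shows "b \<le> s_min T (coord_subspace m \<sigma>)"
  unfolding s_min_def
proof (rule cInf_greatest)
  have "(vnorm (unit_vec m i :: complex vec))\<^sup>2 = (\<Sum>j<m. if j = i then 1 else 0)"
    unfolding vnorm_squared[OF unit_vec_carrier] sqnorm_def using i(2) by (intro sum.cong) auto
  then have "vnorm (unit_vec m i :: complex vec) = 1"
    using i(2) vnorm_nonneg by (simp add: power2_eq_1_iff) (smt (verit) vnorm_nonneg)
  moreover have "(unit_vec m i :: complex vec) \<in> coord_subspace m \<sigma>"
    using i by (auto simp: coord_subspace_iff)
  ultimately show "{vnorm (T *\<^sub>v v) |v. v \<in> coord_subspace m \<sigma> \<and> vnorm v = 1} \<noteq> {}" by blast
qed (use b in auto)

text \<open>Eigenvalues of the Gram kernel are nonnegative, as Rayleigh quotients with numerator the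
  squared norm of an image under \<open>T\<close>. Through \<open>E\<close>, Schatten norms become
  power sums.\<close>

lemma singular_values_gram:
  assumes T: "T \<in> carrier_mat n m"
  obtains E where "char_poly (kernel_mat m (gram_kernel T)) = real_rooted E" "size E = m"
    "\<And>e. e \<in># E \<Longrightarrow> 0 \<le> e"
    "singular_values T = image_mset sqrt E"
proof -
  obtain E where E: "char_poly (kernel_mat m (gram_kernel T)) = real_rooted E" "size E = m"
    using hermitian_char_poly[OF hermitian_gram_kernel] by metis
  have "0 \<le> e" if "e \<in># E" for e
  proof -
    have "eigenvalue (kernel_mat m (gram_kernel T)) (of_real e)"
      using that by (simp add: eigenvalue_iff_mem[OF E(1)])
    then obtain x where x: "sqnorm m x > 0"
      "complex_of_real e = of_real (quad_form m (gram_kernel T) x / sqnorm m x)"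
      by (rule hermitian_eigenvalue[OF hermitian_gram_kernel])
    have "quad_form m (gram_kernel T) (\<lambda>i. vec m x $ i) = quad_form m (gram_kernel T) x"
      by (simp add: quad_form_def inner_fun_def apply_kernel_def)
    then have "0 \<le> quad_form m (gram_kernel T) x"
      using quad_form_gram[OF T, of "vec m x"] zero_le_power2[of "vnorm (T *\<^sub>v vec m x)"] by simp
    moreover have "e = quad_form m (gram_kernel T) x / sqnorm m x" using x(2) of_real_eq_iff by blast
    ultimately show ?thesis using x(1) by simp
  qed
  moreover have "singular_values T = image_mset sqrt E"
    unfolding singular_values_def adjoint_mult_self[OF T] E(1) proots_real_rooted
    by (simp add: image_mset.compositionality o_def)
  ultimately show ?thesis using that E by blast
qed

theorem theorem1p10:
  fixes m n :: nat and T :: "complex mat" and \<delta> :: real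
  assumes "T \<in> carrier_mat n m"
    and "T \<noteq> 0\<^sub>m n m"
    and "0 \<le> \<delta>" and "\<delta> \<le> 1"
    and "\<exists>k::nat. 0 < k \<and> \<delta> * (schatten_norm 2 T ^ 4 / schatten_norm 4 T ^ 4) = real k"
  shows "\<exists>\<sigma> \<subseteq> {0..<m}.
           real (card \<sigma>) = \<delta> * (schatten_norm 2 T ^ 4 / schatten_norm 4 T ^ 4) \<and>
           (let c = real (card \<sigma>) / real m in
             s_min T (coord_subspace m \<sigma>)
               \<ge> schatten_norm 2 T / sqrt (real m) * (sqrt (1 - c) - sqrt (\<delta> - c)))"
proof -
  note T = assms(1)
  let ?a = "gram_kernel T"
  obtain E where E: "char_poly (kernel_mat m ?a) = real_rooted E" "size E = m"
    "\<And>e. e \<in># E \<Longrightarrow> 0 \<le> e" "singular_values T = image_mset sqrt E"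
    using singular_values_gram[OF T] by metis
  obtain k :: nat where k: "0 < k" "\<delta> * (schatten_norm 2 T ^ 4 / schatten_norm 4 T ^ 4) = real k"
    using assms(5) by blast
  \<comment> \<open>\<open>E\<close> holds the squared singular values, so \<open>M1\<close> is the
    square of the Schatten 2-norm and \<open>M2\<close> the fourth power of the 4-norm.\<close>
  define M1 M2 where "M1 = (\<Sum>e\<in>#E. e)" and "M2 = (\<Sum>e\<in>#E. e\<^sup>2)"
  have M1: "M1 \<ge> 0" unfolding M1_def using sum_mset_mono[of E "\<lambda>_. 0" "\<lambda>e. e"] E(3) by simp
  have M2: "M2 \<ge> 0" unfolding M2_def using sum_mset_mono[of E "\<lambda>_. 0" "\<lambda>e. e\<^sup>2"] by simp
  have n2: "schatten_norm 2 T = sqrt M1"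
  proof -
    have "(\<Sum>s\<in>#singular_values T. s powr 2) = M1"
      unfolding E(4) M1_def image_mset.compositionality o_def
      by (intro arg_cong[of _ _ sum_mset] image_mset_cong) (simp add: E(3))
    then show ?thesis using M1 by (simp add: schatten_norm_def powr_half_sqrt)
  qed
  have n4: "schatten_norm 4 T ^ 4 = M2"
  proof -
    have "sqrt e powr 4 = e\<^sup>2" if "e \<in># E" for e
    proof -
      have "sqrt e powr 4 = (sqrt e)^4" using E(3)[OF that] by simp
      also have "\<dots> = ((sqrt e)\<^sup>2)\<^sup>2" by simp
      finally show ?thesis using E(3)[OF that] by simp
    qed
    then have "(\<Sum>s\<in>#singular_values T. s powr 4) = M2"
      unfolding E(4) M2_def image_mset.compositionality o_def
      by (intro arg_cong[of _ _ sum_mset] image_mset_cong) simp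
    then have "schatten_norm 4 T ^ 4 = (M2 powr (1 / 4)) ^ 4" by (simp add: schatten_norm_def)
    also have "\<dots> = M2" using M2 by (cases "M2 = 0") (auto simp: powr_power)
    finally show ?thesis .
  qed
  have "schatten_norm 2 T ^ 4 = ((sqrt M1)\<^sup>2)\<^sup>2" by (simp add: n2)
  then have k2: "\<delta> * (M1\<^sup>2 / M2) = real k" using k(2) M1 by (simp add: n4)
  \<comment> \<open>Division by zero yields zero, so a vanishing moment would force
    \<open>k = 0\<close>.\<close>
  have "M1 \<noteq> 0" "M2 \<noteq> 0" using k2 k(1) by auto
  then have pos: "M1 > 0" "M2 > 0" using M1 M2 by linarith+
  \<comment> \<open>The stable rank is at most \<open>m\<close>, so by
    \<open>\<delta> \<le> 1\<close> there is room for \<open>k\<close> indices.\<close>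
  have "M1\<^sup>2 / M2 \<le> real m"
    using sum_mset_square_le[of E] pos by (simp add: M1_def M2_def E(2) pos_divide_le_eq)
  then have "1 * (M1\<^sup>2 / M2) \<le> real m" by simp
  then have "real k \<le> real m"
    unfolding k2[symmetric] using mult_right_mono[OF assms(4), of "M1\<^sup>2 / M2"] M2 by simp
  then have km: "k \<le> m" by simp
  define c where "c = real k / real m"
  define R where "R = schatten_norm 2 T / sqrt (real m) * (sqrt (1 - c) - sqrt (\<delta> - c))"
  have R2: "R\<^sup>2 = M1 / real m * (sqrt (1 - c) - sqrt (\<delta> - c))\<^sup>2"
    using M1 by (simp add: R_def n2 power_mult_distrib power_divide)
  have "\<exists>\<sigma> \<subseteq> {0..<m}. card \<sigma> = k \<and> R \<le> s_min T (coord_subspace m \<sigma>)"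
  proof (cases "\<delta> = 1")
    case True
    \<comment> \<open>For \<open>\<delta> = 1\<close> the two roots coincide, so
      \<open>R = 0\<close> and any \<open>k\<close> indices do.\<close>
    have "R \<le> s_min T (coord_subspace m {0..<k})"
      by (rule s_min_ge[of 0]) (use k km in \<open>auto simp: R_def True vnorm_nonneg\<close>)
    then show ?thesis using km by (intro exI[of _ "{0..<k}"]) auto
  next
    case False
    with assms(4) have d: "\<delta> < 1" by simp
    have k1: "1 \<le> k" using k(1) by simp
    obtain t \<phi> where t: "t > 0" "\<phi> > 0" "barrier E (- t) \<le> \<phi>"
      "R\<^sup>2 \<le> - t + real (Suc (m - k)) / \<phi>"
      by (rule barrier_bound_exists[OF E(3,2) k1 km pos(1)[unfolded M1_def] d k2[unfolded M1_def M2_def],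
            folded c_def M1_def, folded R2])
    have mk: "k + (m - k) = m" using km by simp
    have tE: "- t < e" if "e \<in># E" for e using E(3)[OF that] t(1) by linarith
    obtain f where f: "inj_on f {..<k}" "f ` {..<k} \<subseteq> {..<m}"
      "\<And>x. (- t + real (Suc (m - k)) / \<phi>) * sqnorm k x \<le> quad_form k (\<lambda>p q. ?a (f p) (f q)) x"
      using exists_principal_submatrix[OF hermitian_gram_kernel k1 t(2), of "m - k", unfolded mk,
          OF E(1,2) tE t(3)] by blast
    have f0: "f 0 \<in> f ` {..<k}" using k(1) by simp
    have "R \<le> s_min T (coord_subspace m (f ` {..<k}))"
    proof (rule s_min_ge[of "f 0"])
      fix v assume v: "v \<in> coord_subspace m (f ` {..<k})" "vnorm v = 1"
      have vc: "v \<in> carrier_vec m" and v0: "\<And>i. i < m \<Longrightarrow> i \<notin> f ` {..<k} \<Longrightarrow> v $ i = 0"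
        using v(1) by (auto simp: coord_subspace_iff)
      \<comment> \<open>\<open>v\<close> is supported on the range of \<open>f\<close>, so its norm
        and form can be read off the principal submatrix.\<close>
      have re: "sqnorm m (\<lambda>i. v $ i) = sqnorm k ((\<lambda>i. v $ i) \<circ> f)"
        "quad_form m ?a (\<lambda>i. v $ i) = quad_form k (\<lambda>p q. ?a (f p) (f q)) ((\<lambda>i. v $ i) \<circ> f)"
        by (rule sqnorm_reindex[OF f(1,2)] quad_form_reindex[OF f(1,2)]; rule v0; assumption)+
      have "R\<^sup>2 \<le> (- t + real (Suc (m - k)) / \<phi>) * sqnorm m (\<lambda>i. v $ i)"
        using t(4) v(2) vnorm_squared[OF vc] by simp
      also have "\<dots> \<le> quad_form m ?a (\<lambda>i. v $ i)"
        unfolding re by (rule f(3))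
      also have "\<dots> = (vnorm (T *\<^sub>v v))\<^sup>2" by (rule quad_form_gram[OF T vc])
      finally show "R \<le> vnorm (T *\<^sub>v v)" by (rule power2_le_imp_le) (rule vnorm_nonneg)
    qed (use f0 subsetD[OF f(2) f0] in auto)
    moreover have "card (f ` {..<k}) = k" using f(1) by (simp add: card_image)
    ultimately show ?thesis using f(2) by (intro exI[of _ "f ` {..<k}"]) auto
  qed
  then show ?thesis unfolding k(2) R_def c_def Let_def by auto
qed

end
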